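(* Consider the closed-loop error dynamics $\dot{\tilde{\mathbf p}}_e=f_{cl}(\tilde{\mathbf p}_e,\mathbf p_{e,0},u_0)$ of the general 2-trailer system under the feedback $\tilde u=-K\tilde{\mathbf p}_e$, as defined in the context. Let the set of paths be given by $(\mathbf p_{e,0},u_0)\in\mathbb P\times\mathbb U$, where $\mathbb P$ and $\mathbb U$ are bounded. Assume that, for some $r>0$ and $\tilde{\mathbb P}=\{\tilde{\mathbf p}_e\in\mathbb R^4 : \|\tilde{\mathbf p}_e\|_2<r\}$, the function $f_{cl}:\tilde{\mathbb P}\times\mathbb P\times\mathbb U\to\mathbb R^4$ is continuously differentiable with respect to $\tilde{\mathbf p}_e\in\tilde{\mathbb P}$ and the Jacobian matrix $[\partial f_{cl}/\partial\tilde{\mathbf p}_e]$ is bounded and Lipschitz (in $\tilde{\mathbf p}_e$) on $\tilde{\mathbb P}$, uniformly in $(\mathbf p_{e,0},u_0)\in\mathbb P\times\mathbb U$. Let $$A_{cl}(\mathbf p_{e,0},u_0)=\frac{\partial f_{cl}}{\partial\tilde{\mathbf p}_e}(\bar 0,\mathbf p_{e,0},u_0)$$ and define the convex hull $$\bar{\mathbb A}_{cl}=\mathbf{Co}\,\{A_{cl}(\mathbf p_{e,0},u_0)\in\mathbb R^{4\times4} : (\mathbf p_{e,0},u_0)\in\mathbb P\times\mathbb U\}.$$ If there exist matrices $P=P^T\succ0$ and $Q=Q^T\succ0$ that satisfy $$PA_{cl}+A_{cl}^TP\preceq -Q\qquad\text{for all } A_{cl}\in\bar{\mathbb A}_{cl},$$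 then $\tilde{\mathbf p}_e=\bar 0$ is an exponentially stable equilibrium point of $\dot{\tilde{\mathbf p}}_e=f_{cl}(\tilde{\mathbf p}_e,\mathbf p_{e,0},u_0)$ for all $(\mathbf p_{e,0},u_0)\in\mathbb P\times\mathbb U$, in the sense given in the context (the parameters $(\mathbf p_{e,0},u_0)$ may vary with time within $\mathbb P\times\mathbb U$).
   Context: Constants: $L_1,L_2,L_3>0$, $M_1\in\mathbb R$ (geometric lengths of the vehicle; $M_1$ is the off-axle hitching length) and $v_3\neq0$ (constant trailer velocity). State and parameters: the error state is $\tilde{\mathbf p}_e=[z_3,\tilde\theta_3,\tilde\beta_3,\tilde\beta_2]^T\in\mathbb R^4$ (lateral error, trailer heading error, and errors in the two hitch angles). The nominal path enters through $\mathbf p_{e,0}=[0,0,\beta_{3,0},\beta_{2,0}]^T$ and $u_0\in\mathbb R$ (tangent of the nominal steering angle). $\mathbb P$ is a set of vectors $\mathbf p_{e,0}$ of this form and $\mathbb U\subset\mathbb R$. The path curvature is $\kappa_0=\tan\beta_{3,0}/L_3$. Write $\beta_3=\tilde\beta_3+\beta_{3,0}$, $\beta_2=\tilde\beta_2+\beta_{2,0}$, $u=\tilde u+u_0$ and $C_2(\beta,w)=1+\frac{M_1}{L_1}w\tan\beta$. Open-loop error dynamics $\dot{\tilde{\mathbf p}}_e=f_e(\tilde{\mathbf p}_e,\tilde u,\mathbf p_{e,0},u_0)$: $$\dot z_3=v_3\sin\tilde\theta_3,$$ $$\dot{\tilde\theta}_3=v_3\left(\frac{\tan\beta_3}{L_3}-\frac{\kappa_0\cos\tilde\theta_3}{1-\kappa_0z_3}\right),$$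 $$\dot{\tilde\beta}_3=v_3\left(\frac{\tan\beta_2-\frac{M_1}{L_1}u}{L_2\cos\beta_3\,C_2(\beta_2,u)}-\frac{\tan\beta_3}{L_3}-\frac{\cos\tilde\theta_3}{1-\kappa_0z_3}\left(\frac{\tan\beta_{2,0}-\frac{M_1}{L_1}u_0}{L_2\cos\beta_{3,0}\,C_2(\beta_{2,0},u_0)}-\kappa_0\right)\right),$$ $$\dot{\tilde\beta}_2=v_3\left(\frac{\frac{u}{L_1\cos\beta_2}-\frac{\tan\beta_2}{L_2}+\frac{M_1}{L_1L_2}u}{\cos\beta_3\,C_2(\beta_2,u)}-\frac{\cos\tilde\theta_3}{1-\kappa_0z_3}\cdot\frac{\frac{u_0}{L_1\cos\beta_{2,0}}-\frac{\tan\beta_{2,0}}{L_2}+\frac{M_1}{L_1L_2}u_0}{\cos\beta_{3,0}\,C_2(\beta_{2,0},u_0)}\right).$$ The model is considered where $|\beta_3|,|\beta_2|,|\beta_{3,0}|,|\beta_{2,0}|<\pi/2$, $|\tilde\theta_3|<\pi/2$, $1-\kappa_0z_3>0$, and the factors $C_2$ do not vanish. One has $f_e(\bar0,0,\mathbf p_{e,0},u_0)=\bar0$. Closed loop: $f_{cl}(\tilde{\mathbf p}_e,\mathbf p_{e,0},u_0)=f_e(\tilde{\mathbf p}_e,-K\tilde{\mathbf p}_e,\mathbf p_{e,0},u_0)$, so $f_{cl}(\bar0,\mathbf p_{e,0},u_0)=\bar0$. Here $K\in\mathbb R^{1\times4}$ is the LQ gain $K=B^TS$, where $S=S^T\succ0$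 is the (unique) positive definite solution of $A^TS+SA+W=SBB^TS$ for a chosen weight $W=W^T\succeq0$, and $$A=v_3\begin{bmatrix}0&1&0&0\\0&0&\frac1{L_3}&0\\0&0&-\frac1{L_3}&\frac1{L_2}\\0&0&0&-\frac1{L_2}\end{bmatrix},\qquad B=v_3\begin{bmatrix}0\\0\\-\frac{M_1}{L_1L_2}\\\frac{L_2+M_1}{L_1L_2}\end{bmatrix}$$ are the linearization matrices of $f_e$ at $\tilde{\mathbf p}_e=\bar0$, $\tilde u=0$, $\mathbf p_{e,0}=\bar0$, $u_0=0$. Meaning of the conclusion: along a path the parameters $(\mathbf p_{e,0},u_0)$ vary with the traveled distance, hence with time, and this dependence is treated as a parametric uncertainty. Exponential stability for all $(\mathbf p_{e,0},u_0)\in\mathbb P\times\mathbb U$ means that for every piecewise continuous function $t\mapsto(\mathbf p_{e,0}(t),u_0(t))\in\mathbb P\times\mathbb U$ (constant functions included) such that $t\mapsto f_{cl}(\tilde{\mathbf p},\mathbf p_{e,0}(t),u_0(t))$ is piecewise continuous for each $\tilde{\mathbf p}\in\tilde{\mathbb P}$, there are $c,k,\lambda>0$ such that every solution of $\dot{\tilde{\mathbf p}}_e=f_{cl}(\tilde{\mathbf p}_e,\mathbf p_{e,0}(t),u_0(t))$ with $\|\tilde{\mathbf p}_e(t_0)\|_2<c$ satisfies $\|\tilde{\mathbf p}_e(t)\|_2\le k\|\tilde{\mathbf p}_e(t_0)\|_2e^{-\lambda(t-t_0)}$ for all $t\ge t_0$. Notation: $\mathbf{Co}$ is the convex hull, $\bar0$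 the zero vector, and $\succ,\succeq,\preceq$ refer to the order on symmetric matrices. *)

theory Defs
  imports "HOL-Analysis.Analysis"
begin

section \<open>Order on symmetric matrices\<close>

definition psd :: "real^'n^'n \<Rightarrow> bool" where
  "psd M \<longleftrightarrow> transpose M = M \<and> (\<forall>x. 0 \<le> x \<bullet> (M *v x))"

definition pos_def :: "real^'n^'n \<Rightarrow> bool" where
  "pos_def M \<longleftrightarrow> transpose M = M \<and> (\<forall>x. x \<noteq> 0 \<longrightarrow> 0 < x \<bullet> (M *v x))"

definition loewner_le :: "real^'n^'n \<Rightarrow> real^'n^'n \<Rightarrow> bool" (infix \<open>\<preceq>\<^sub>L\<close> 50) where
  "M \<preceq>\<^sub>L N \<longleftrightarrow> psd (N - M)"


section \<open>The general 2-trailer system\<close>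

text \<open>
  An error state is \<open>p = (z3, theta3~, beta3~, beta2~)\<close> and a nominal path parameter is
  \<open>p0 = (0, 0, beta30, beta20)\<close>, so the components 3 and 4 of \<open>p + p0\<close> are the hitch angles
  \<open>beta3\<close> and \<open>beta2\<close>.  \<open>du\<close> is the control error \<open>u - u0\<close>.
\<close>

definition C2 :: "real \<Rightarrow> real \<Rightarrow> real \<Rightarrow> real \<Rightarrow> real" where
  "C2 L1 M1 \<beta> w = 1 + M1 / L1 * w * tan \<beta>"

definition curvature :: "real \<Rightarrow> real^4 \<Rightarrow> real" where
  "curvature L3 p0 = tan (p0 $ 3) / L3"

definition f_e ::
  "real \<Rightarrow> real \<Rightarrow> real \<Rightarrow> real \<Rightarrow> real \<Rightarrow> real^4 \<Rightarrow> real \<Rightarrow> real^4 \<Rightarrow> real \<Rightarrow> real^4" where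
  "f_e L1 L2 L3 M1 v3 p du p0 u0 =
    (let z3 = p $ 1; \<theta>3 = p $ 2;
         \<beta>30 = p0 $ 3; \<beta>20 = p0 $ 4;
         \<beta>3 = p $ 3 + \<beta>30; \<beta>2 = p $ 4 + \<beta>20;
         u = du + u0; \<kappa>0 = curvature L3 p0
     in vector
      [v3 * sin \<theta>3,
       v3 * (tan \<beta>3 / L3 - \<kappa>0 * cos \<theta>3 / (1 - \<kappa>0 * z3)),
       v3 * ((tan \<beta>2 - M1 / L1 * u) / (L2 * cos \<beta>3 * C2 L1 M1 \<beta>2 u)
             - tan \<beta>3 / L3
             - cos \<theta>3 / (1 - \<kappa>0 * z3)
               * ((tan \<beta>20 - M1 / L1 * u0) / (L2 * cos \<beta>30 * C2 L1 M1 \<beta>20 u0) - \<kappa>0)),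
       v3 * ((u / (L1 * cos \<beta>2) - tan \<beta>2 / L2 + M1 / (L1 * L2) * u)
               / (cos \<beta>3 * C2 L1 M1 \<beta>2 u)
             - cos \<theta>3 / (1 - \<kappa>0 * z3)
               * ((u0 / (L1 * cos \<beta>20) - tan \<beta>20 / L2 + M1 / (L1 * L2) * u0)
                  / (cos \<beta>30 * C2 L1 M1 \<beta>20 u0)))])"

text \<open>The region where the model is considered; outside it, \<open>f_e\<close> has no meaning.\<close>

definition model_domain ::
  "real \<Rightarrow> real \<Rightarrow> real \<Rightarrow> real^4 \<Rightarrow> real \<Rightarrow> real^4 \<Rightarrow> real \<Rightarrow> bool" where
  "model_domain L1 L3 M1 p du p0 u0 \<longleftrightarrow>
     \<bar>p $ 3 + p0 $ 3\<bar> < pi / 2 \<and> \<bar>p $ 4 + p0 $ 4\<bar> < pi / 2 \<and>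
     \<bar>p0 $ 3\<bar> < pi / 2 \<and> \<bar>p0 $ 4\<bar> < pi / 2 \<and>
     \<bar>p $ 2\<bar> < pi / 2 \<and>
     0 < 1 - curvature L3 p0 * p $ 1 \<and>
     C2 L1 M1 (p $ 4 + p0 $ 4) (du + u0) \<noteq> 0 \<and> C2 L1 M1 (p0 $ 4) u0 \<noteq> 0"

definition lin_A :: "real \<Rightarrow> real \<Rightarrow> real \<Rightarrow> real^4^4" where
  "lin_A L2 L3 v3 = v3 *\<^sub>R vector
     [vector [0, 1, 0, 0],
      vector [0, 0, 1 / L3, 0],
      vector [0, 0, - (1 / L3), 1 / L2],
      vector [0, 0, 0, - (1 / L2)]]"

definition lin_B :: "real \<Rightarrow> real \<Rightarrow> real \<Rightarrow> real \<Rightarrow> real^1^4" where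
  "lin_B L1 L2 M1 v3 = v3 *\<^sub>R columnvector
     (vector [0, 0, - (M1 / (L1 * L2)), (L2 + M1) / (L1 * L2)])"

text \<open>
  \<open>K\<close> is the LQ gain for the state weight \<open>W\<close>.  Since \<open>(A, B)\<close> has no uncontrollable mode at 0,
  the Riccati equation has at most one positive definite solution, so \<open>K\<close> is determined by \<open>W\<close>.
\<close>

definition is_lq_gain :: "real^4^4 \<Rightarrow> real^1^4 \<Rightarrow> real^4^4 \<Rightarrow> real^4^1 \<Rightarrow> bool" where
  "is_lq_gain A B W K \<longleftrightarrow>
     (\<exists>S. pos_def S \<and> transpose A ** S + S ** A + W = S ** B ** transpose B ** S
          \<and> K = transpose B ** S)"

definition feedback :: "real^4^1 \<Rightarrow> real^4 \<Rightarrow> real" where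
  "feedback K p = - ((K *v p) $ 1)"

definition f_cl ::
  "real \<Rightarrow> real \<Rightarrow> real \<Rightarrow> real \<Rightarrow> real \<Rightarrow> real^4^1 \<Rightarrow> real^4 \<Rightarrow> real^4 \<Rightarrow> real \<Rightarrow> real^4" where
  "f_cl L1 L2 L3 M1 v3 K p p0 u0 = f_e L1 L2 L3 M1 v3 p (feedback K p) p0 u0"

definition cl_domain ::
  "real \<Rightarrow> real \<Rightarrow> real \<Rightarrow> real^4^1 \<Rightarrow> real^4 \<Rightarrow> real \<Rightarrow> (real^4) set" where
  "cl_domain L1 L3 M1 K p0 u0 = {p. model_domain L1 L3 M1 p (feedback K p) p0 u0}"

definition cl_jacobian ::
  "real \<Rightarrow> real \<Rightarrow> real \<Rightarrow> real \<Rightarrow> real \<Rightarrow> real^4^1 \<Rightarrow> real^4 \<Rightarrow> real^4 \<Rightarrow> real \<Rightarrow> real^4^4" where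
  "cl_jacobian L1 L2 L3 M1 v3 K p p0 u0 = jacobian (\<lambda>q. f_cl L1 L2 L3 M1 v3 K q p0 u0) (at p)"

definition A_cl ::
  "real \<Rightarrow> real \<Rightarrow> real \<Rightarrow> real \<Rightarrow> real \<Rightarrow> real^4^1 \<Rightarrow> real^4 \<Rightarrow> real \<Rightarrow> real^4^4" where
  "A_cl L1 L2 L3 M1 v3 K p0 u0 = cl_jacobian L1 L2 L3 M1 v3 K 0 p0 u0"


section \<open>Exponential stability under time-varying parameters\<close>

definition piecewise_continuous :: "(real \<Rightarrow> 'a::topological_space) \<Rightarrow> bool" where
  "piecewise_continuous f \<longleftrightarrow>
     (\<forall>a b. finite {t \<in> {a..b}. \<not> isCont f t}) \<and>
     (\<forall>t. (\<exists>l. (f \<longlongrightarrow> l) (at_left t)) \<and> (\<exists>l. (f \<longlongrightarrow> l) (at_right t)))"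

text \<open>
  Solutions of \<open>x' = F t x\<close>, \<open>x t \<in> D t\<close>, on an interval \<open>J\<close>.  As \<open>F\<close> may jump in \<open>t\<close>, they are
  continuous and satisfy the equation up to finitely many times in every bounded interval.
\<close>

definition ode_solution ::
  "(real \<Rightarrow> 'a::real_normed_vector \<Rightarrow> 'a) \<Rightarrow> (real \<Rightarrow> 'a set) \<Rightarrow> real set \<Rightarrow> (real \<Rightarrow> 'a) \<Rightarrow> bool" where
  "ode_solution F D J x \<longleftrightarrow>
     continuous_on J x \<and> (\<forall>t\<in>J. x t \<in> D t) \<and>
     (\<forall>a b. finite {t \<in> J \<inter> {a..b}. \<not> (x has_vector_derivative F t (x t)) (at t within J)})"

text \<open>
  The solution \<open>x\<close> may be given on any interval \<open>J\<close> starting at \<open>t0\<close>, including bounded ones and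
  the single point \<open>{t0}\<close>.  That it satisfies the estimate for all \<open>t \<ge> t0\<close> is taken to include that
  it continues to all of \<open>{t0..}\<close>: a finite escape time is not compatible with stability.
\<close>

definition exponentially_stable_origin ::
  "(real \<Rightarrow> 'a::real_normed_vector \<Rightarrow> 'a) \<Rightarrow> (real \<Rightarrow> 'a set) \<Rightarrow> bool" where
  "exponentially_stable_origin F D \<longleftrightarrow>
     (\<forall>t. 0 \<in> D t \<and> F t 0 = 0) \<and>
     (\<exists>c>0. \<exists>k>0. \<exists>\<mu>>0. \<forall>t0 J x.
        is_interval J \<and> t0 \<in> J \<and> J \<subseteq> {t0..} \<and> ode_solution F D J x \<and> norm (x t0) < c \<longrightarrow>
        (\<exists>y. (\<forall>t\<in>J. y t = x t) \<and> ode_solution F D {t0..} y \<and>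
             (\<forall>t\<ge>t0. norm (y t) \<le> k * norm (x t0) * exp (- \<mu> * (t - t0)))))"

text \<open>
  Parameter signals are defined on the whole real line and \<open>t0\<close> is arbitrary.  This covers signals
  on a half-line: extend them by their initial value.
\<close>

definition robustly_exponentially_stable ::
  "('a::real_normed_vector \<Rightarrow> 'b::topological_space \<Rightarrow> 'c::topological_space \<Rightarrow> 'a) \<Rightarrow>
   ('b \<Rightarrow> 'c \<Rightarrow> 'a set) \<Rightarrow> 'a set \<Rightarrow> 'b set \<Rightarrow> 'c set \<Rightarrow> bool" where
  "robustly_exponentially_stable f D X PP UU \<longleftrightarrow>
     (\<forall>p0 u0. (\<forall>t. p0 t \<in> PP \<and> u0 t \<in> UU) \<longrightarrow>
        piecewise_continuous (\<lambda>t. (p0 t, u0 t)) \<longrightarrow>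
        (\<forall>p\<in>X. piecewise_continuous (\<lambda>t. f p (p0 t) (u0 t))) \<longrightarrow>
        exponentially_stable_origin (\<lambda>t p. f p (p0 t) (u0 t)) (\<lambda>t. D (p0 t) (u0 t)))"

end

theory Submission
  imports Defs
begin

text \<open>
  \<open>V p = p \<bullet> P p\<close> is a common quadratic Lyapunov function for all parameter values.  Writing
  \<open>f_cl p = A_cl p + R p\<close>, the matrix inequality bounds the contribution of \<open>A_cl p\<close> to the derivative
  of \<open>V\<close> by \<open>- p \<bullet> Q p\<close>, and the Lipschitz Jacobian gives \<open>|R p| \<le> C |p|\<^sup>2\<close> with the same \<open>C\<close> for
  all parameters, so \<open>R\<close> costs at most half of that decay on a small ball.  As the estimate is uniform,
  it does not matter how the parameters vary in time.  Existence of solutions for all times comes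
  from the bounded Jacobian, which makes the field uniformly Lipschitz on the ball.
\<close>

section \<open>Differential equations with finitely many exceptional times\<close>

text \<open>The fundamental theorem of calculus with finitely many exceptional points writes
  \<open>h b - h a\<close> as the integral of the derivative; continuity of \<open>h\<close> rules
  out jumps at the exceptional times.\<close>

lemma nonincreasing_except_finite:
  fixes h :: "real \<Rightarrow> real"
  assumes "finite S" "a \<le> b" "continuous_on {a..b} h"
    and h': "\<And>t. t \<in> {a<..<b} - S \<Longrightarrow> \<exists>d\<le>0. (h has_real_derivative d) (at t)"
  shows "h b \<le> h a"
proof -
  obtain d where d: "\<And>t. t \<in> {a<..<b} - S \<Longrightarrow> d t \<le> 0 \<and> (h has_real_derivative d t) (at t)"
    using h' by metis
  \<comment> \<open>The default value 0 keeps the integrand nonpositive on the whole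
    interval.\<close>
  let ?d = "\<lambda>t. if t \<in> {a<..<b} - S then d t else 0"
  have "(?d has_integral (h b - h a)) {a..b}"
    using assms(1-3) d
    by (intro fundamental_theorem_of_calculus_interior_strong)
      (auto simp: has_real_derivative_iff_has_vector_derivative)
  then have "h b - h a \<le> 0"
    by (rule has_integral_le[OF _ has_integral_0]) (use d in auto)
  then show ?thesis by simp
qed

text \<open>Gronwall's lemma: the integrating factor \<open>exp (- c * (t - a))\<close> reduces it
  to monotonicity. The sign of \<open>c\<close> is free: a positive rate serves uniqueness, 0
  confinement to a ball, a negative rate exponential decay.\<close>

lemma differential_inequality:
  fixes h :: "real \<Rightarrow> real"
  assumes "finite S" "a \<le> b" "continuous_on {a..b} h"
    and h': "\<And>t. t \<in> {a<..<b} - S \<Longrightarrow> \<exists>d\<le>c * h t. (h has_real_derivative d) (at t)"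
  shows "h b \<le> exp (c * (b - a)) * h a"
proof -
  let ?k = "\<lambda>t. exp (- c * (t - a)) * h t"
  have "?k b \<le> ?k a"
  proof (rule nonincreasing_except_finite[OF assms(1,2)])
    show "continuous_on {a..b} ?k" by (intro continuous_intros assms(3))
    fix t assume "t \<in> {a<..<b} - S"
    then obtain d where d: "d \<le> c * h t" "(h has_real_derivative d) (at t)" using h' by blast
    then have "(?k has_real_derivative exp (- c * (t - a)) * (d - c * h t)) (at t)"
      by (auto intro!: derivative_eq_intros simp: algebra_simps)
    moreover have "exp (- c * (t - a)) * (d - c * h t) \<le> 0"
      using d(1) by (intro mult_nonneg_nonpos) auto
    ultimately show "\<exists>d\<le>0. (?k has_real_derivative d) (at t)" by blast
  qed
  then have "exp (c * (b - a)) * ?k b \<le> exp (c * (b - a)) * h a" by simp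
  then show ?thesis by (simp add: mult.assoc[symmetric] mult_exp_exp)
qed

text \<open>In the interior of \<open>J\<close> the derivative within \<open>J\<close> is a full
  derivative, the form that \<open>differential_inequality\<close> consumes.\<close>

lemma ode_solution_derivative:
  assumes "ode_solution F D J x" "{a..b} \<subseteq> J"
  obtains S where "finite S"
    "\<And>t. t \<in> {a<..<b} - S \<Longrightarrow> (x has_vector_derivative F t (x t)) (at t)"
proof
  let ?S = "{t \<in> J \<inter> {a..b}. \<not> (x has_vector_derivative F t (x t)) (at t within J)}"
  show "finite ?S" using assms(1) unfolding ode_solution_def by blast
  fix t assume t: "t \<in> {a<..<b} - ?S"
  then have "t \<in> {a..b}" by simp
  then have "t \<in> J" using assms(2) by blast
  then have "(x has_vector_derivative F t (x t)) (at t within J)"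
    using t by auto
  moreover have "t \<in> interior J"
    using t assms(2) interior_mono[OF assms(2)] by auto
  ultimately show "(x has_vector_derivative F t (x t)) (at t)"
    using at_within_interior by metis
qed

text \<open>Only the values of the field along the trajectory matter, so a solution can be passed
  between a field and its truncation while it stays where the two agree.\<close>

lemma ode_solution_cong:
  assumes "ode_solution F D J x" "J' \<subseteq> J"
    and "\<And>t. t \<in> J' \<Longrightarrow> G t (x t) = F t (x t)" "\<And>t. t \<in> J' \<Longrightarrow> x t \<in> D' t"
  shows "ode_solution G D' J' x"
  unfolding ode_solution_def
proof (intro conjI allI)
  show "continuous_on J' x"
    using assms(1,2) continuous_on_subset unfolding ode_solution_def by blast
  show "\<forall>t\<in>J'. x t \<in> D' t" using assms(4) by blast
  fix a b
  have "{t \<in> J' \<inter> {a..b}. \<not> (x has_vector_derivative G t (x t)) (at t within J')}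
      \<subseteq> {t \<in> J \<inter> {a..b}. \<not> (x has_vector_derivative F t (x t)) (at t within J)}"
    using assms(2,3) by (auto intro: has_vector_derivative_within_subset)
  moreover have "finite {t \<in> J \<inter> {a..b}. \<not> (x has_vector_derivative F t (x t)) (at t within J)}"
    using assms(1) unfolding ode_solution_def by blast
  ultimately show "finite {t \<in> J' \<inter> {a..b}. \<not> (x has_vector_derivative G t (x t)) (at t within J')}"
    by (rule finite_subset)
qed

text \<open>These are the properties of the field after truncation: one Lipschitz constant on the
  whole space and for all times. The locally finite set \<open>E\<close> holds the times at which
  the parameters may jump.\<close>

locale lipschitz_field =
  fixes g :: "real \<Rightarrow> 'a::euclidean_space \<Rightarrow> 'a" and E :: "real set" and L :: real
  assumes L_pos: "0 < L"
    and finite_E: "\<And>a b. finite (E \<inter> {a..b})"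
    and cont_time: "\<And>t v. t \<notin> E \<Longrightarrow> isCont (\<lambda>s. g s v) t"
    and lipschitz: "\<And>t v w. norm (g t v - g t w) \<le> L * norm (v - w)"
    and zero: "\<And>t. g t 0 = 0"
begin

section \<open>Uniqueness of solutions and continuity along curves\<close>

lemma growth: "norm (g t v) \<le> L * norm v"
  using lipschitz[of t v 0] by (simp add: zero)

text \<open>The squared distance of two solutions grows at rate at most \<open>2 * L\<close> and
  starts at 0.\<close>

lemma unique:
  assumes x: "ode_solution g (\<lambda>_. UNIV) {a..b} x" and y: "ode_solution g (\<lambda>_. UNIV) {a..b} y"
    and "x a = y a" "a \<le> b"
  shows "x b = y b"
proof -
  let ?w = "\<lambda>t. x t - y t"
  let ?h = "\<lambda>t. ?w t \<bullet> ?w t"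
  obtain S where S: "finite S"
    "\<And>t. t \<in> {a<..<b} - S \<Longrightarrow> (x has_vector_derivative g t (x t)) (at t)"
    using ode_solution_derivative[OF x order_refl] by blast
  obtain T where T: "finite T"
    "\<And>t. t \<in> {a<..<b} - T \<Longrightarrow> (y has_vector_derivative g t (y t)) (at t)"
    using ode_solution_derivative[OF y order_refl] by blast
  have "?h b \<le> exp (2 * L * (b - a)) * ?h a"
  proof (rule differential_inequality[of "S \<union> T" a b ?h "2 * L"])
    show "continuous_on {a..b} ?h"
      using x y unfolding ode_solution_def by (intro continuous_intros) auto
    fix t assume t: "t \<in> {a<..<b} - (S \<union> T)"
    let ?e = "g t (x t) - g t (y t)"
    have w: "(?w has_vector_derivative ?e) (at t)"
      using S T t by (intro has_vector_derivative_diff) auto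
    have "(?h has_derivative (\<lambda>s. ?w t \<bullet> (s *\<^sub>R ?e) + (s *\<^sub>R ?e) \<bullet> ?w t)) (at t)"
      using has_derivative_inner w unfolding has_vector_derivative_def by blast
    then have "(?h has_real_derivative 2 * (?w t \<bullet> ?e)) (at t)"
      unfolding has_field_derivative_def
      by (rule has_derivative_eq_rhs) (auto simp: inner_commute algebra_simps fun_eq_iff)
    moreover have "2 * (?w t \<bullet> ?e) \<le> 2 * L * ?h t"
    proof -
      have "?w t \<bullet> ?e \<le> norm (?w t) * norm ?e" by (rule norm_cauchy_schwarz)
      also have "\<dots> \<le> norm (?w t) * (L * norm (?w t))"
        by (intro mult_left_mono lipschitz) auto
      finally show ?thesis by (simp add: power2_norm_eq_inner[symmetric] power2_eq_square mult_ac)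
    qed
    ultimately show "\<exists>d\<le>2 * L * ?h t. (?h has_real_derivative d) (at t)" by blast
  qed (use S T assms in auto)
  then have "?h b \<le> 0" using assms(3) by simp
  then show ?thesis by (metis inner_gt_zero_iff not_less right_minus_eq)
qed

lemma isCont_along:
  assumes "t \<notin> E" "isCont w t"
  shows "isCont (\<lambda>s. g s (w s)) t"
proof -
  have "((\<lambda>s. g s (w s) - g s (w t)) \<longlongrightarrow> 0) (at t)"
  proof (rule Lim_null_comparison)
    show "\<forall>\<^sub>F s in at t. norm (g s (w s) - g s (w t)) \<le> L * norm (w s - w t)"
      by (simp add: lipschitz)
    have "((\<lambda>s. L * norm (w s - w t)) \<longlongrightarrow> L * norm (w t - w t)) (at t)"
      using assms(2) unfolding isCont_def by (intro tendsto_intros)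
    then show "((\<lambda>s. L * norm (w s - w t)) \<longlongrightarrow> 0) (at t)" by simp
  qed
  moreover have "((\<lambda>s. g s (w t)) \<longlongrightarrow> g t (w t)) (at t)"
    using cont_time[OF assms(1)] unfolding isCont_def .
  ultimately have "((\<lambda>s. (g s (w s) - g s (w t)) + g s (w t)) \<longlongrightarrow> 0 + g t (w t)) (at t)"
    by (rule tendsto_add)
  then show ?thesis by (simp add: isCont_def)
qed

section \<open>Global existence through the integral equation\<close>

lemma countable_E: "countable E"
proof -
  have "E = (\<Union>n. E \<inter> {- real n..real n})"
  proof (intro equalityI subsetI)
    fix t assume "t \<in> E"
    moreover obtain n where "\<bar>t\<bar> \<le> real n" using real_arch_simple by blast
    ultimately show "t \<in> (\<Union>n. E \<inter> {- real n..real n})" by (auto intro!: exI[of _ n])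
  qed auto
  moreover have "countable (\<Union>n. E \<inter> {- real n..real n})"
    using finite_E by (intro countable_UN) (auto intro: countable_finite)
  ultimately show ?thesis by metis
qed

text \<open>Continuity outside a countable set gives measurability, and linear growth gives a
  continuous dominating function.\<close>

lemma integrable_along:
  assumes w: "continuous_on UNIV w"
  shows "(\<lambda>s. g s (w s)) integrable_on {a..b}"
proof (rule measurable_bounded_by_integrable_imp_integrable)
  have "continuous_on (- E) (\<lambda>s. g s (w s))"
    using w isCont_along
    by (auto intro!: continuous_at_imp_continuous_on simp: continuous_on_eq_continuous_at)
  then have "(\<lambda>s. g s (w s)) \<in> borel_measurable borel"
    using borel_measurable_continuous_countable_exceptions countable_E by blast
  then show "(\<lambda>s. g s (w s)) \<in> borel_measurable (lebesgue_on {a..b})"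
    by (intro measurable_restrict_space1 borel_measurable_if_D) 
       (simp add: measurable_completion)
  show "(\<lambda>s. L * norm (w s)) integrable_on {a..b}"
    by (intro integrable_continuous_interval continuous_intros continuous_on_subset[OF w]) auto
qed (auto intro: growth)

text \<open>Integration reproduces the exponential weight up to the factor \<open>1 / l\<close>; the
  contribution of the lower limit is dropped by its sign.\<close>

lemma integral_exp_le:
  assumes "l > 0" "a \<le> b" "0 \<le> B"
  shows "integral {a..b} (\<lambda>s. L * (exp (l * (s - a)) * B)) \<le> L / l * B * exp (l * (b - a))"
proof -
  have "((\<lambda>s. L * (exp (l * (s - a)) * B)) has_integral
      (L / l * B * exp (l * (b - a)) - L / l * B * exp (l * (a - a)))) {a..b}"
    using assms by (intro fundamental_theorem_of_calculus)
      (auto intro!: derivative_eq_intros simp: has_real_derivative_iff_has_vector_derivative[symmetric])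
  from integral_unique[OF this] show ?thesis
    using assms L_pos by (simp only:) simp
qed

text \<open>
  Picard iteration for \<open>z t = exp (- 2 L (t - a)) y t\<close>: with this weight the integral operator
  contracts by \<open>1/2\<close> on all of \<open>{a..}\<close>, so no continuation of local solutions is needed.
\<close>

lemma global_fixed_point:
  fixes a :: real and v :: 'a
  obtains y where "continuous_on UNIV y"
    "\<And>t. a \<le> t \<Longrightarrow> y t = v + integral {a..t} (\<lambda>s. g s (y s))"
proof -
  \<comment> \<open>This choice makes the contraction factor \<open>L / l\<close> equal to
    \<open>1 / 2\<close>.\<close>
  define l where "l = 2 * L"
  have l: "l > 0" using L_pos by (simp add: l_def)
  \<comment> \<open>\<open>w z\<close> removes the weight: it is the candidate solution
    \<open>y\<close> belonging to \<open>z\<close>.\<close>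
  define w where "w z s = exp (l * (s - a)) *\<^sub>R apply_bcontfun z s" for z :: "real \<Rightarrow>\<^sub>C 'a" and s
  \<comment> \<open>Bounded continuous functions live on the whole line, so \<open>max t a\<close>
    extends the Picard operator by the constant \<open>v\<close> to the left of
    \<open>a\<close>.\<close>
  define T where "T z t = exp (- (l * (max t a - a))) *\<^sub>R
      (v + integral {a..max t a} (\<lambda>s. g s (w z s)))" for z and t
  have w: "continuous_on UNIV (w z)" for z
    unfolding w_def by (intro continuous_intros continuous_on_apply_bcontfun)
  have int: "(\<lambda>s. g s (w z s)) integrable_on {a..t}" for z t
    by (rule integrable_along[OF w])
  have gw: "norm (integral {a..t} (\<lambda>s. g s (w z s)) - integral {a..t} (\<lambda>s. g s (w z' s)))
      \<le> 1 / 2 * dist z z' * exp (l * (t - a))" if "a \<le> t" for z z' t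
  proof -
    have "norm (integral {a..t} (\<lambda>s. g s (w z s) - g s (w z' s)))
        \<le> integral {a..t} (\<lambda>s. L * (exp (l * (s - a)) * dist z z'))"
    proof (rule integral_norm_bound_integral)
      show "(\<lambda>s. L * (exp (l * (s - a)) * dist z z')) integrable_on {a..t}"
        by (intro integrable_continuous_interval continuous_intros)
      show "norm (g s (w z s) - g s (w z' s)) \<le> L * (exp (l * (s - a)) * dist z z')" for s
      proof -
        have "norm (w z s - w z' s) = exp (l * (s - a)) * dist (z s) (z' s)"
          by (simp add: w_def dist_norm flip: scaleR_diff_right)
        also have "\<dots> \<le> exp (l * (s - a)) * dist z z'"
          by (simp add: dist_bounded)
        finally have "L * norm (w z s - w z' s) \<le> L * (exp (l * (s - a)) * dist z z')"
          using L_pos by simp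
        then show ?thesis using lipschitz order_trans by blast
      qed
    qed (intro integrable_diff int)
    also have "\<dots> \<le> L / l * dist z z' * exp (l * (t - a))"
      using that l by (intro integral_exp_le) auto
    finally show ?thesis using L_pos int by (simp add: l_def integral_diff)
  qed
  have w0: "w 0 s = 0" for s by (simp add: w_def)
  have T_diff: "dist (T z t) (T z' t) \<le> 1 / 2 * dist z z'" for z z' t
  proof -
    have "dist (T z t) (T z' t) = exp (- (l * (max t a - a))) *
       norm (integral {a..max t a} (\<lambda>s. g s (w z s)) - integral {a..max t a} (\<lambda>s. g s (w z' s)))"
      by (simp add: T_def dist_norm flip: scaleR_diff_right)
    also have "\<dots> \<le> exp (- (l * (max t a - a))) * (1 / 2 * dist z z' * exp (l * (max t a - a)))"
      by (intro mult_left_mono gw) auto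
    also have "\<dots> = 1 / 2 * dist z z'" by (simp only: exp_minus) simp
    finally show ?thesis .
  qed
  have T_bcontfun: "T z \<in> bcontfun" for z
  proof (rule bcontfun_normI)
    have I: "continuous_on UNIV (\<lambda>t. integral {a..max t a} (\<lambda>s. g s (w z s)))"
    proof (rule continuous_at_imp_continuous_on, rule ballI)
      fix t
      have "continuous_on {a..max t a + 1} (\<lambda>u. integral {a..u} (\<lambda>s. g s (w z s)))"
        by (rule indefinite_integral_continuous_1[OF int])
      then have "continuous_on {..t + 1} (\<lambda>t. integral {a..max t a} (\<lambda>s. g s (w z s)))"
        by (rule continuous_on_compose2) (auto intro!: continuous_intros)
      then show "isCont (\<lambda>t. integral {a..max t a} (\<lambda>s. g s (w z s))) t"
        by (rule continuous_on_interior) (auto simp: interior_Iic)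
    qed
    show "continuous_on UNIV (T z)"
      unfolding T_def by (intro continuous_intros I)
    fix t
    \<comment> \<open>Boundedness needs only one reference point: \<open>g\<close> vanishes along
      the zero curve, so \<open>T 0\<close> is bounded by \<open>norm v\<close>, and the contraction
      estimate covers the difference.\<close>
    have "norm (T z t) \<le> norm (T 0 t) + dist (T z t) (T 0 t)"
      using norm_triangle_ineq[of "T 0 t" "T z t - T 0 t"] by (simp add: dist_norm)
    also have "norm (T 0 t) \<le> norm v"
      using l by (simp add: T_def w0 zero mult_left_le_one_le)
    finally show "norm (T z t) \<le> norm v + 1 / 2 * dist z 0"
      using T_diff[of z t 0] by simp
  qed
  have "\<exists>!z. Bcontfun (T z) = z"
  proof (rule banach_fix_type)
    show "\<forall>z z'. dist (Bcontfun (T z)) (Bcontfun (T z')) \<le> 1 / 2 * dist z z'"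
      using T_diff by (intro allI dist_bound) (simp add: Bcontfun_inverse T_bcontfun)
  qed auto
  then obtain z where z: "Bcontfun (T z) = z" by blast
  then have zT: "apply_bcontfun z = T z"
    by (metis Bcontfun_inverse T_bcontfun)
  have "w z t = v + integral {a..t} (\<lambda>s. g s (w z s))" if "a \<le> t" for t
  proof -
    have "w z t = exp (l * (t - a)) *\<^sub>R T z t" by (simp add: w_def zT)
    then show ?thesis using that by (simp add: T_def max_def flip: exp_add)
  qed
  then show ?thesis using that w by blast
qed

lemma global_solution:
  obtains y where "ode_solution g (\<lambda>_. UNIV) {a..} y" "y a = v"
proof -
  obtain y where y: "continuous_on UNIV y"
    "\<And>t. a \<le> t \<Longrightarrow> y t = v + integral {a..t} (\<lambda>s. g s (y s))"
    using global_fixed_point[of a v] by blast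
  have der: "(y has_vector_derivative g t (y t)) (at t within {a..})" if "a \<le> t" "t \<notin> E" for t
  proof -
    have "isCont y t" using y(1) by (simp add: continuous_on_eq_continuous_at)
    then have c: "isCont (\<lambda>s. g s (y s)) t" by (rule isCont_along[OF that(2)])
    \<comment> \<open>The endpoint \<open>t + 1\<close> leaves room to the right of
      \<open>t\<close>, so the filter agrees with the one within \<open>{a..}\<close>, also at
      \<open>t = a\<close>.\<close>
    have "((\<lambda>u. integral {a..u} (\<lambda>s. g s (y s))) has_vector_derivative g t (y t))
        (at t within ({a..t + 1} - {}))"
      using that integrable_along[OF y(1)]
      by (intro integral_has_vector_derivative_continuous_at
          continuous_at_imp_continuous_at_within[OF c]) auto
    moreover have "at t within ({a..t + 1} - {}) = at t within {a..}"
      by (rule at_within_nhd[of _ "{t - 1<..<t + 1}"]) auto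
    ultimately have "((\<lambda>u. v + integral {a..u} (\<lambda>s. g s (y s))) has_vector_derivative g t (y t))
        (at t within {a..})"
      by (auto intro!: derivative_eq_intros)
    then show ?thesis
      by (rule has_vector_derivative_transform[rotated 2]) (use that y(2) in auto)
  qed
  have "ode_solution g (\<lambda>_. UNIV) {a..} y"
    unfolding ode_solution_def
  proof (intro conjI allI)
    fix c d
    have "{t \<in> {a..} \<inter> {c..d}. \<not> (y has_vector_derivative g t (y t)) (at t within {a..})} \<subseteq> E \<inter> {c..d}"
      using der by auto
    then show "finite {t \<in> {a..} \<inter> {c..d}. \<not> (y has_vector_derivative g t (y t)) (at t within {a..})}"
      using finite_E finite_subset by blast
  qed (use continuous_on_subset[OF y(1)] in auto)
  moreover have "y a = v" using y(2)[of a] by simp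
  ultimately show ?thesis using that by blast
qed

end

section \<open>Quadratic forms\<close>

text \<open>Cauchy-Schwarz in each row; the norm of a matrix in this type is the Frobenius
  norm.\<close>

lemma norm_matrix_vector_le:
  fixes A :: "real^'n^'m"
  shows "norm (A *v x) \<le> norm A * norm x"
proof -
  have "L2_set (\<lambda>i. norm ((A *v x) $ i)) UNIV \<le> L2_set (\<lambda>i. norm (A $ i) * norm x) UNIV"
    by (intro L2_set_mono) (auto simp: matrix_vector_mul_component Cauchy_Schwarz_ineq2)
  also have "\<dots> = L2_set (\<lambda>i. norm (A $ i)) UNIV * norm x"
    by (simp add: L2_set_left_distrib)
  finally show ?thesis by (simp add: norm_vec_def)
qed

lemma inner_symmetric_matrix:
  fixes P :: "real^'n^'n"
  assumes "transpose P = P"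
  shows "x \<bullet> (P *v y) = y \<bullet> (P *v x)"
  by (metis assms dot_lmul_matrix inner_commute transpose_matrix_vector)

text \<open>The constant is the minimum of the form on the compact unit sphere; homogeneity of
  degree two carries the bound to all vectors.\<close>

lemma pos_def_coercive:
  fixes P :: "real^'n^'n"
  assumes "pos_def P"
  obtains m where "m > 0" "\<And>x. m * (norm x)\<^sup>2 \<le> x \<bullet> (P *v x)"
proof -
  have "continuous_on (sphere 0 1) (\<lambda>x. x \<bullet> (P *v x))"
    by (intro continuous_intros linear_continuous_on matrix_vector_mul_bounded_linear)
  moreover have "sphere 0 1 \<noteq> ({} :: (real^'n) set)" by simp
  ultimately obtain e where e: "norm e = 1" "\<And>x. norm x = 1 \<Longrightarrow> e \<bullet> (P *v e) \<le> x \<bullet> (P *v x)"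
    using continuous_attains_inf[of "sphere 0 1" "\<lambda>x. x \<bullet> (P *v x)"] by auto
  show ?thesis
  proof
    have "e \<noteq> 0" using e(1) by auto
    then show "0 < e \<bullet> (P *v e)" using assms unfolding pos_def_def by blast
    fix x :: "real^'n"
    show "e \<bullet> (P *v e) * (norm x)\<^sup>2 \<le> x \<bullet> (P *v x)"
    proof (cases "x = 0")
      case False
      let ?u = "x /\<^sub>R norm x"
      have "e \<bullet> (P *v e) \<le> ?u \<bullet> (P *v ?u)" using False by (intro e) simp
      also have "\<dots> = (x \<bullet> (P *v x)) / (norm x)\<^sup>2"
        by (simp add: matrix_vector_mult_scaleR power2_eq_square divide_inverse)
      finally show ?thesis using False by (simp add: pos_le_divide_eq)
    qed simp
  qed
qed

lemma quadratic_form_has_derivative: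
  fixes P :: "real^'n^'n"
  assumes "transpose P = P" and y: "(y has_vector_derivative d) (at t)"
  shows "((\<lambda>t. y t \<bullet> (P *v y t)) has_real_derivative 2 * (y t \<bullet> (P *v d))) (at t)"
proof -
  have y': "(y has_derivative (\<lambda>s. s *\<^sub>R d)) (at t)"
    using y unfolding has_vector_derivative_def .
  then have "((\<lambda>t. P *v y t) has_derivative (\<lambda>s. P *v (s *\<^sub>R d))) (at t)"
    by (rule bounded_linear.has_derivative[OF matrix_vector_mul_bounded_linear])
  from has_derivative_inner[OF y' this] show ?thesis
    unfolding has_field_derivative_def
    by (rule has_derivative_eq_rhs)
      (auto simp: matrix_vector_mult_scaleR inner_symmetric_matrix[OF assms(1), of d] fun_eq_iff)
qed

text \<open>By symmetry of \<open>P\<close> the two summands have the same quadratic form, whence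
  the factor 2.\<close>

lemma lyapunov_inequality:
  fixes P A Q :: "real^'n^'n"
  assumes "transpose P = P" "P ** A + transpose A ** P \<preceq>\<^sub>L - Q"
  shows "2 * (x \<bullet> (P *v (A *v x))) \<le> - (x \<bullet> (Q *v x))"
proof -
  have "0 \<le> x \<bullet> ((- Q - (P ** A + transpose A ** P)) *v x)"
    using assms(2) unfolding loewner_le_def psd_def by blast
  moreover have "(- Q) *v x = - (Q *v x)"
    using matrix_vector_mult_diff_rdistrib[of 0 Q x] by simp
  moreover have "x \<bullet> (transpose A *v (P *v x)) = x \<bullet> (P *v (A *v x))"
    by (metis assms(1) dot_lmul_matrix inner_commute transpose_matrix_vector)
  ultimately show ?thesis
    by (simp add: matrix_vector_mult_diff_rdistrib matrix_vector_mult_add_rdistrib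
        inner_diff_right inner_add_right matrix_vector_mul_assoc[symmetric] del: transpose_matrix_vector)
qed

section \<open>Lyapunov stability for fields that are Lipschitz near the origin\<close>

text \<open>Outside the ball the closest point is the radial rescaling, by the reverse triangle
  inequality. Describing the radial projection as \<open>closest_point\<close> makes its
  nonexpansiveness available from convexity.\<close>

lemma closest_point_cball_0:
  fixes v :: "'a::euclidean_space"
  assumes "\<rho> > 0"
  obtains s where "s \<ge> 1" "v = s *\<^sub>R closest_point (cball 0 \<rho>) v"
proof (cases "norm v \<le> \<rho>")
  case True
  then have "closest_point (cball 0 \<rho>) v = v" by (simp add: closest_point_self)
  then show ?thesis using that[of 1] by simp
next
  case False
  let ?p = "(\<rho> / norm v) *\<^sub>R v"
  have "?p = closest_point (cball 0 \<rho>) v"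
  proof (rule closest_point_unique)
    show "?p \<in> cball 0 \<rho>" using False assms by simp
    show "\<forall>z\<in>cball 0 \<rho>. dist v ?p \<le> dist v z"
    proof
      fix z :: 'a assume z: "z \<in> cball 0 \<rho>"
      have "\<rho> / norm v < 1"
        using False assms less_trans[of 0 \<rho> "norm v"] by (simp add: divide_less_eq)
      have "v - ?p = (1 - \<rho> / norm v) *\<^sub>R v" by (simp add: scaleR_diff_left)
      then have "dist v ?p = \<bar>1 - \<rho> / norm v\<bar> * norm v" by (simp add: dist_norm)
      also have "\<bar>1 - \<rho> / norm v\<bar> = 1 - \<rho> / norm v" using \<open>\<rho> / norm v < 1\<close> by simp
      also have "\<dots> * norm v = norm v - \<rho>" using False assms by (auto simp: left_diff_distrib)
      also have "\<dots> \<le> dist v z"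
        using z norm_triangle_sub[of v z] by (simp add: dist_norm)
      finally show "dist v ?p \<le> dist v z" .
    qed
  qed auto
  moreover have "v = (norm v / \<rho>) *\<^sub>R ?p" using False assms by auto
  ultimately show ?thesis using False assms that[of "norm v / \<rho>"] by simp
qed

text \<open>
  The field is replaced by \<open>g t v = F t (\<pi> v)\<close> with \<open>\<pi>\<close> the radial projection onto a small ball.
  Since \<open>v\<close> is a multiple \<open>s \<ge> 1\<close> of \<open>\<pi> v\<close>, the quadratic form decreases along \<open>g\<close> on the whole
  space, which confines the global solutions of \<open>g\<close> to the ball where \<open>g = F\<close>.
\<close>

theorem quadratic_lyapunov_exponentially_stable:
  fixes F :: "real \<Rightarrow> real^'n \<Rightarrow> real^'n" and P :: "real^'n^'n"
  assumes P: "pos_def P" and "0 < L" "0 < a" "0 < \<rho>"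
    and finite_E: "\<And>a b. finite (E \<inter> {a..b})"
    and cont_time: "\<And>t v. t \<notin> E \<Longrightarrow> norm v \<le> \<rho> \<Longrightarrow> isCont (\<lambda>s. F s v) t"
    and lipschitz: "\<And>t v w. norm v \<le> \<rho> \<Longrightarrow> norm w \<le> \<rho> \<Longrightarrow> norm (F t v - F t w) \<le> L * norm (v - w)"
    and F_zero: "\<And>t. F t 0 = 0"
    and dom: "\<And>t. cball 0 \<rho> \<subseteq> D t"
    and decay: "\<And>t v. norm v \<le> \<rho> \<Longrightarrow> 2 * (v \<bullet> (P *v F t v)) \<le> - a * (norm v)\<^sup>2"
  shows "exponentially_stable_origin F D"
proof -
  have sym: "transpose P = P" using P unfolding pos_def_def by blast
  define V where "V v = v \<bullet> (P *v v)" for v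
  obtain m where m: "m > 0" "\<And>v. m * (norm v)\<^sup>2 \<le> V v"
    using pos_def_coercive[OF P] unfolding V_def by blast
  define M where "M = norm P + 1"
  have M: "M > 0" "V v \<le> M * (norm v)\<^sup>2" for v
  proof -
    show "M > 0" using norm_ge_zero[of P] unfolding M_def by linarith
    have "V v \<le> norm v * norm (P *v v)" unfolding V_def by (rule norm_cauchy_schwarz)
    also have "\<dots> \<le> norm v * (norm P * norm v)"
      by (intro mult_left_mono norm_matrix_vector_le) auto
    finally have "V v \<le> norm P * (norm v)\<^sup>2" by (simp add: power2_eq_square mult_ac)
    then show "V v \<le> M * (norm v)\<^sup>2" by (simp add: M_def distrib_right add_increasing2)
  qed
  have cont_V: "continuous_on S (\<lambda>t. V (y t))" if "continuous_on S y" for S :: "real set" and y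
    unfolding V_def by (intro continuous_intros that
        bounded_linear.continuous_on[OF matrix_vector_mul_bounded_linear])

  define \<pi> where "\<pi> = closest_point (cball (0 :: real^'n) \<rho>)"
  define g where "g t v = F t (\<pi> v)" for t v
  have \<pi>_le: "norm (\<pi> v) \<le> \<rho>" for v
    using closest_point_in_set[of "cball 0 \<rho>" v] \<open>0 < \<rho>\<close> by (simp add: \<pi>_def)
  have \<pi>_id: "\<pi> v = v" if "norm v \<le> \<rho>" for v
    using that by (simp add: \<pi>_def closest_point_self)
  interpret lipschitz_field g E L
  proof
    fix t v w
    have "norm (g t v - g t w) \<le> L * norm (\<pi> v - \<pi> w)"
      unfolding g_def by (intro lipschitz \<pi>_le)
    also have "\<dots> \<le> L * norm (v - w)"
      using closest_point_lipschitz[of "cball 0 \<rho>" v w] \<open>0 < L\<close> \<open>0 < \<rho>\<close>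
      by (intro mult_left_mono) (auto simp: \<pi>_def dist_norm)
    finally show "norm (g t v - g t w) \<le> L * norm (v - w)" .
  qed (use \<open>0 < L\<close> \<open>0 < \<rho>\<close> finite_E cont_time \<pi>_le in \<open>auto simp: g_def F_zero \<pi>_id\<close>)

  have g_nonpos: "2 * (v \<bullet> (P *v g t v)) \<le> 0" for t v
  proof -
    obtain s where s: "s \<ge> 1" "v = s *\<^sub>R \<pi> v"
      using closest_point_cball_0[OF \<open>0 < \<rho>\<close>] unfolding \<pi>_def by blast
    have "2 * (\<pi> v \<bullet> (P *v g t v)) \<le> - a * (norm (\<pi> v))\<^sup>2"
      using decay[OF \<pi>_le] unfolding g_def .
    also have "\<dots> \<le> 0" using \<open>0 < a\<close> by simp
    finally have "s * (\<pi> v \<bullet> (P *v g t v)) \<le> 0" using s(1) by (simp add: mult_le_0_iff)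
    then have "(s *\<^sub>R \<pi> v) \<bullet> (P *v g t v) \<le> 0" by simp
    then show ?thesis using s(2) by simp
  qed
  have V_exp: "V (y b) \<le> exp (c * (b - t0)) * V (y t0)"
    if y: "ode_solution g (\<lambda>_. UNIV) {t0..} y" and "t0 \<le> b"
      and c: "\<And>t. t0 \<le> t \<Longrightarrow> 2 * (y t \<bullet> (P *v g t (y t))) \<le> c * V (y t)" for y t0 b c
  proof -
    have sub: "{t0..b} \<subseteq> {t0..}" by auto
    obtain S where S: "finite S"
      "\<And>t. t \<in> {t0<..<b} - S \<Longrightarrow> (y has_vector_derivative g t (y t)) (at t)"
      using ode_solution_derivative[OF y sub] by blast
    show ?thesis
    proof (rule differential_inequality[of S t0 b "\<lambda>t. V (y t)"])
      show "continuous_on {t0..b} (\<lambda>t. V (y t))"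
        using y sub continuous_on_subset unfolding ode_solution_def by (intro cont_V) blast
      fix t assume "t \<in> {t0<..<b} - S"
      then have "((\<lambda>t. V (y t)) has_real_derivative 2 * (y t \<bullet> (P *v g t (y t)))) (at t)"
        "2 * (y t \<bullet> (P *v g t (y t))) \<le> c * V (y t)"
        using quadratic_form_has_derivative[OF sym S(2)] c unfolding V_def by auto
      then show "\<exists>d\<le>c * V (y t). ((\<lambda>t. V (y t)) has_real_derivative d) (at t)" by blast
    qed fact+
  qed

  \<comment> \<open>\<open>c\<close> solves \<open>M * c\<^sup>2 = m * \<rho>\<^sup>2\<close>, so
    the sublevel set of \<open>V\<close> reached from the \<open>c\<close>-ball lies in the
    \<open>\<rho>\<close>-ball. Comparison with \<open>V\<close> turns decay \<open>a\<close> into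
    rate \<open>a / M\<close>; \<open>\<mu>\<close> is half of it because \<open>V\<close> is
    quadratic, and \<open>k\<close> is the square root of the ratio of the bounds on
    \<open>V\<close>.\<close>
  define c where "c = \<rho> * sqrt (m / M)"
  define \<mu> where "\<mu> = a / (2 * M)"
  define k where "k = sqrt (M / m)"
  have pos: "c > 0" "\<mu> > 0" "k > 0"
    using m(1) M(1) \<open>0 < \<rho>\<close> \<open>0 < a\<close> by (auto simp: c_def \<mu>_def k_def)
  \<comment> \<open>Monotonicity of \<open>V\<close> along \<open>g\<close> holds on the whole
    space, so confinement is obtained first, without circularity, and then makes the strict decay
    available in \<open>bound\<close>.\<close>
  have stay: "norm (y t) < \<rho>"
    if y: "ode_solution g (\<lambda>_. UNIV) {t0..} y" and "norm (y t0) < c" "t0 \<le> t" for y t0 t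
  proof -
    have "m * (norm (y t))\<^sup>2 \<le> V (y t)" by (rule m(2))
    also have "\<dots> \<le> exp (0 * (t - t0)) * V (y t0)"
      using g_nonpos by (intro V_exp y that) auto
    also have "\<dots> \<le> M * (norm (y t0))\<^sup>2" using M(2) by simp
    also have "\<dots> < M * c\<^sup>2"
      using M(1) that(2) by (intro mult_strict_left_mono power_strict_mono) auto
    also have "\<dots> = m * \<rho>\<^sup>2"
      using M(1) m(1) by (simp add: c_def power_mult_distrib)
    finally have "(norm (y t))\<^sup>2 < \<rho>\<^sup>2" using m(1) by simp
    then show ?thesis using \<open>0 < \<rho>\<close> by (simp add: power_less_imp_less_base)
  qed
  have bound: "norm (y t) \<le> k * norm (y t0) * exp (- \<mu> * (t - t0))"
    if y: "ode_solution g (\<lambda>_. UNIV) {t0..} y" and "norm (y t0) < c" "t0 \<le> t" for y t0 t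
  proof (rule power2_le_imp_le)
    have "m * (norm (y t))\<^sup>2 \<le> V (y t)" by (rule m(2))
    also have "\<dots> \<le> exp (- (2 * \<mu>) * (t - t0)) * V (y t0)"
    proof (intro V_exp y that)
      fix s assume "t0 \<le> s"
      then have s: "norm (y s) \<le> \<rho>" using stay[OF y that(2)] by (simp add: less_imp_le)
      then have "2 * (y s \<bullet> (P *v g s (y s))) \<le> - a * (norm (y s))\<^sup>2"
        using decay unfolding g_def by (simp add: \<pi>_id)
      also have "\<dots> = - (2 * \<mu>) * (M * (norm (y s))\<^sup>2)"
        using M(1) by (simp add: \<mu>_def)
      also have "\<dots> \<le> - (2 * \<mu>) * V (y s)"
        using M(2) pos(2) by (intro mult_left_mono_neg) auto
      finally show "2 * (y s \<bullet> (P *v g s (y s))) \<le> - (2 * \<mu>) * V (y s)" .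
    qed
    also have "\<dots> \<le> exp (- (2 * \<mu>) * (t - t0)) * (M * (norm (y t0))\<^sup>2)"
      by (intro mult_left_mono M(2)) auto
    also have "exp (- (2 * \<mu>) * (t - t0)) = (exp (- \<mu> * (t - t0)))\<^sup>2"
      by (simp add: exp_double[symmetric] mult_ac)
    finally have "(norm (y t))\<^sup>2 \<le> M / m * (norm (y t0))\<^sup>2 * (exp (- \<mu> * (t - t0)))\<^sup>2"
      using m(1) by (simp add: field_simps)
    also have "M / m = k\<^sup>2" using m(1) M(1) by (simp add: k_def)
    finally show "(norm (y t))\<^sup>2 \<le> (k * norm (y t0) * exp (- \<mu> * (t - t0)))\<^sup>2"
      by (simp add: power_mult_distrib)
  qed (use pos in auto)

  \<comment> \<open>The candidate continuation is the global solution \<open>y\<close> of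
    \<open>g\<close>. The given solution \<open>x\<close> follows \<open>F\<close>, about which
    nothing is known outside the ball, so it must be shown that \<open>x\<close> never leaves the
    ball.\<close>
  have extend: "\<exists>y. (\<forall>t\<in>J. y t = x t) \<and> ode_solution F D {t0..} y \<and>
      (\<forall>t\<ge>t0. norm (y t) \<le> k * norm (x t0) * exp (- \<mu> * (t - t0)))"
    if J: "is_interval J" "t0 \<in> J" "J \<subseteq> {t0..}" and x: "ode_solution F D J x" and "norm (x t0) < c"
    for t0 J x
  proof -
    obtain y where y: "ode_solution g (\<lambda>_. UNIV) {t0..} y" and y0: "y t0 = x t0"
      using global_solution by blast
    have y_lt: "norm (y t) < \<rho>" if "t0 \<le> t" for t
      using stay[OF y] that y0 \<open>norm (x t0) < c\<close> by simp
    have "ode_solution F D {t0..} y"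
      by (rule ode_solution_cong[OF y])
        (use y_lt dom in \<open>auto simp: g_def \<pi>_id less_imp_le subset_iff\<close>)
    moreover have sub: "{t0..t} \<subseteq> J" if "t \<in> J" for t
      using J that mem_is_interval_1_I[OF J(1), of t0 t] by auto
    have eq: "x t = y t" if "t \<in> J" and le: "\<And>s. s \<in> {t0..t} \<Longrightarrow> norm (x s) \<le> \<rho>" for t
    proof (rule unique[of t0 t])
      show "ode_solution g (\<lambda>_. UNIV) {t0..t} x"
        by (rule ode_solution_cong[OF x sub[OF that(1)]]) (use le in \<open>auto simp: g_def \<pi>_id\<close>)
      show "ode_solution g (\<lambda>_. UNIV) {t0..t} y"
        by (rule ode_solution_cong[OF y]) auto
    qed (use y0 J that in auto)
    have x_le: "norm (x t) \<le> \<rho>" if "t \<in> J" for t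
    proof (rule ccontr)
      assume "\<not> norm (x t) \<le> \<rho>"
      moreover have "norm (x t0) < \<rho>" using y_lt[of t0] y0 by simp
      moreover have "t0 \<le> t" using J that by auto
      moreover have nx: "continuous_on {t0..t} (\<lambda>s. norm (x s))"
        using x sub[OF that] continuous_on_subset unfolding ode_solution_def
        by (intro continuous_intros) blast
      \<comment> \<open>If \<open>x\<close> left the ball there would be a first time
        \<open>s\<close> with norm \<open>\<rho>\<close>. Up to \<open>s\<close> uniqueness applies
        and gives \<open>x s = y s\<close>, but \<open>y\<close> stays strictly inside.\<close>
      ultimately have ne: "{t0..t} \<inter> (\<lambda>s. norm (x s)) -` {\<rho>} \<noteq> {}"
        using IVT'[of "\<lambda>s. norm (x s)" t0 \<rho> t] by auto
      have "closed ({t0..t} \<inter> (\<lambda>s. norm (x s)) -` {\<rho>})"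
        by (rule continuous_closed_preimage[OF nx]) simp_all
      moreover have "bounded ({t0..t} \<inter> (\<lambda>s. norm (x s)) -` {\<rho>})"
        by (rule bounded_subset[of "{t0..t}"]) simp_all
      ultimately have "compact ({t0..t} \<inter> (\<lambda>s. norm (x s)) -` {\<rho>})"
        by (simp add: compact_eq_bounded_closed)
      then obtain s where s: "s \<in> {t0..t}" "norm (x s) = \<rho>"
        and first: "\<And>s'. s' \<in> {t0..t} \<Longrightarrow> norm (x s') = \<rho> \<Longrightarrow> s \<le> s'"
        using compact_attains_inf[OF _ ne] by auto
      \<comment> \<open>A larger norm at \<open>s'\<close> would force a crossing of level
        \<open>\<rho>\<close> no later than \<open>s'\<close>, hence at \<open>s\<close> itself by
        minimality, so \<open>s' = s\<close>, where the norm is exactly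
        \<open>\<rho>\<close>.\<close>
      have "norm (x s') \<le> \<rho>" if s': "s' \<in> {t0..s}" for s'
      proof (rule ccontr)
        assume "\<not> norm (x s') \<le> \<rho>"
        moreover have "continuous_on {t0..s'} (\<lambda>s. norm (x s))"
          using nx s(1) s' by (auto intro: continuous_on_subset)
        ultimately obtain s'' where "t0 \<le> s''" "s'' \<le> s'" "norm (x s'') = \<rho>"
          using IVT'[of "\<lambda>s. norm (x s)" t0 \<rho> s'] \<open>norm (x t0) < \<rho>\<close> s' by auto
        moreover from this have "s'' = s" using first[of s''] s s' by auto
        ultimately show False using s s' \<open>\<not> norm (x s') \<le> \<rho>\<close> by auto
      qed
      then have "x s = y s" using eq[of s] sub[OF \<open>t \<in> J\<close>] s(1) by auto
      then show False using y_lt[of s] s by auto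
    qed
    have "y t = x t" if "t \<in> J" for t
      by (rule eq[OF that, symmetric]) (use x_le sub[OF that] in blast)
    moreover have "norm (y t) \<le> k * norm (x t0) * exp (- \<mu> * (t - t0))" if "t0 \<le> t" for t
      using bound[OF y _ that] y0 \<open>norm (x t0) < c\<close> by simp
    ultimately show ?thesis by blast
  qed
  have "0 \<in> D t" for t using dom[of t] \<open>0 < \<rho>\<close> by auto
  then show ?thesis
    unfolding exponentially_stable_origin_def using F_zero pos extend by blast
qed

section \<open>Fields with Lipschitz Jacobian\<close>

text \<open>Mean value inequality on a convex set, the operator norm being at most the Frobenius
  norm.\<close>

lemma jacobian_bound_imp_lipschitz:
  fixes f :: "real^'n \<Rightarrow> real^'m"
  assumes "convex S"
    and "\<And>x. x \<in> S \<Longrightarrow> f differentiable (at x)"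
    and "\<And>x. x \<in> S \<Longrightarrow> norm (jacobian f (at x)) \<le> C"
    and "x \<in> S" "y \<in> S"
  shows "norm (f x - f y) \<le> C * norm (x - y)"
proof (rule differentiable_bound[OF \<open>convex S\<close>])
  fix x assume x: "x \<in> S"
  show "(f has_derivative (*v) (jacobian f (at x))) (at x within S)"
    using assms(2)[OF x] jacobian_works has_derivative_at_withinI by blast
  show "onorm ((*v) (jacobian f (at x))) \<le> C"
  proof (rule onorm_le)
    fix h :: "real^'n"
    have "norm (jacobian f (at x) *v h) \<le> norm (jacobian f (at x)) * norm h"
      by (rule norm_matrix_vector_le)
    also have "\<dots> \<le> C * norm h" using assms(3)[OF x] by (intro mult_right_mono) auto
    finally show "norm (jacobian f (at x) *v h) \<le> C * norm h" .
  qed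
qed fact+

text \<open>The mean value inequality is applied to the remainder on \<open>cball 0 (norm v)\<close>
  instead of the full ball: there its derivative is at most \<open>C * norm v\<close>, which yields
  the second power.\<close>

lemma linearization_error:
  fixes f :: "real^'n \<Rightarrow> real^'m"
  assumes "\<And>x. x \<in> ball 0 r \<Longrightarrow> f differentiable (at x)"
    and "C-lipschitz_on (ball 0 r) (\<lambda>x. jacobian f (at x))"
    and "f 0 = 0" and v: "v \<in> ball 0 r"
  shows "norm (f v - jacobian f (at 0) *v v) \<le> C * (norm v)\<^sup>2"
proof -
  let ?A = "jacobian f (at 0)"
  have "norm ((f v - ?A *v v) - (f 0 - ?A *v 0)) \<le> C * norm v * norm (v - 0)"
  proof (rule differentiable_bound)
    fix x assume x: "x \<in> cball (0 :: real^'n) (norm v)"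
    then have "x \<in> ball 0 r" using v by auto
    then have "(f has_derivative (*v) (jacobian f (at x))) (at x within cball 0 (norm v))"
      using assms(1) jacobian_works has_derivative_at_withinI by blast
    then show "((\<lambda>x. f x - ?A *v x) has_derivative (\<lambda>h. jacobian f (at x) *v h - ?A *v h))
        (at x within cball 0 (norm v))"
      by (intro has_derivative_diff bounded_linear_imp_has_derivative matrix_vector_mul_bounded_linear)
    show "onorm (\<lambda>h. jacobian f (at x) *v h - ?A *v h) \<le> C * norm v"
    proof (rule onorm_le)
      fix h :: "real^'n"
      have "norm (jacobian f (at x) - ?A) \<le> C * norm (x - 0)"
        using lipschitz_onD[OF assms(2) \<open>x \<in> ball 0 r\<close>, of 0] v
        by (simp add: dist_norm order_le_less_trans[OF norm_ge_zero])
      also have "\<dots> \<le> C * norm v"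
        using x lipschitz_on_nonneg[OF assms(2)] by (intro mult_left_mono) auto
      finally have le: "norm (jacobian f (at x) - ?A) \<le> C * norm v" .
      have "norm ((jacobian f (at x) - ?A) *v h) \<le> norm (jacobian f (at x) - ?A) * norm h"
        by (rule norm_matrix_vector_le)
      also have "\<dots> \<le> C * norm v * norm h" using le by (intro mult_right_mono) auto
      finally show "norm (jacobian f (at x) *v h - ?A *v h) \<le> C * norm v * norm h"
        by (simp add: matrix_vector_mult_diff_rdistrib)
    qed
  qed auto
  then show ?thesis by (simp add: assms(3) power2_eq_square mult_ac)
qed

section \<open>The general 2-trailer system\<close>

lemma vector_4 [simp]:
  "(vector [a, b, c, d] :: 'a::zero^4) $ 1 = a"
  "(vector [a, b, c, d] :: 'a::zero^4) $ 2 = b"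
  "(vector [a, b, c, d] :: 'a::zero^4) $ 3 = c"
  "(vector [a, b, c, d] :: 'a::zero^4) $ 4 = d"
  by (simp_all add: vector_def)

lemma f_cl_0: "f_cl L1 L2 L3 M1 v3 K 0 p0 u0 = 0"
  by (simp add: f_cl_def f_e_def Let_def feedback_def curvature_def vec_eq_iff forall_4 mult_ac)

text \<open>At a fixed error state in the model domain no denominator vanishes and all hitch angles
  avoid the poles of the tangent, so continuity passes from the parameters to the field.\<close>

lemma isCont_f_cl:
  fixes p0 :: "real \<Rightarrow> real^4"
  assumes "L1 > 0" "L2 > 0" "L3 > 0"
    and p: "p \<in> cl_domain L1 L3 M1 K (p0 t) (u0 t)"
    and p0: "isCont p0 t" and u0: "isCont u0 t"
  shows "isCont (\<lambda>s. f_cl L1 L2 L3 M1 v3 K p (p0 s) (u0 s)) t"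
proof -
  have dom: "\<bar>p $ 3 + p0 t $ 3\<bar> < pi / 2" "\<bar>p $ 4 + p0 t $ 4\<bar> < pi / 2"
    "\<bar>p0 t $ 3\<bar> < pi / 2" "\<bar>p0 t $ 4\<bar> < pi / 2"
    "1 - curvature L3 (p0 t) * p $ 1 \<noteq> 0"
    "C2 L1 M1 (p $ 4 + p0 t $ 4) (feedback K p + u0 t) \<noteq> 0" "C2 L1 M1 (p0 t $ 4) (u0 t) \<noteq> 0"
    using p unfolding cl_domain_def model_domain_def by auto
  have cos: "cos \<theta> \<noteq> 0" if "\<bar>\<theta>\<bar> < pi / 2" for \<theta>
  proof -
    have "0 < cos \<theta>" using that by (intro cos_gt_zero_pi) linarith+
    then show ?thesis by simp
  qed
  have comp: "isCont (\<lambda>s. p0 s $ i) t" for i using p0 by (rule isCont_vec_nth)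
  note nz = dom(5,6,7) cos[OF dom(1)] cos[OF dom(2)] cos[OF dom(3)] cos[OF dom(4)]
  have tan: "isCont (\<lambda>s. tan (c + p0 s $ i)) t" if "cos (c + p0 t $ i) \<noteq> 0" for c i
    by (rule isCont_tan'[OF isCont_add[OF continuous_const comp] that])
  have tan0: "isCont (\<lambda>s. tan (p0 s $ i)) t" if "cos (p0 t $ i) \<noteq> 0" for i
    by (rule isCont_tan'[OF comp that])
  note tans = tan[OF nz(4)] tan[OF nz(5)] tan0[OF nz(6)] tan0[OF nz(7)]
  have curv: "isCont (\<lambda>s. curvature L3 (p0 s)) t"
    unfolding curvature_def using assms(3) by (intro isCont_divide continuous_const tans) simp
  have C2: "isCont (\<lambda>s. C2 L1 M1 (p $ 4 + p0 s $ 4) (feedback K p + u0 s)) t"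
    "isCont (\<lambda>s. C2 L1 M1 (p0 s $ 4) (u0 s)) t"
    unfolding C2_def by (intro isCont_add isCont_mult continuous_const tans u0)+
  have cosines: "isCont (\<lambda>s. cos (c + p0 s $ i)) t" "isCont (\<lambda>s. cos (p0 s $ i)) t" for c i
    by (intro isCont_cos' isCont_add continuous_const comp)+
  note intros = isCont_add isCont_diff isCont_mult isCont_divide continuous_const
    tans curv C2 cosines u0
  have "isCont (\<lambda>s. f_cl L1 L2 L3 M1 v3 K p (p0 s) (u0 s) $ i) t" for i
  proof -
    consider "i = 1" | "i = 2" | "i = 3" | "i = 4" using exhaust_4[of i] by blast
    then show ?thesis
      \<comment> \<open>The continuity rules leave only nonvanishing denominators, which are
        products of the factors in \<open>nz\<close> and the positive lengths.\<close>
      by cases (simp_all only: f_cl_def f_e_def Let_def vector_4,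
        (intro intros; use nz assms(1-3) in simp)+)
  qed
  then show ?thesis unfolding isCont_def by (intro vec_tendstoI)
qed

lemma finite_discontinuities_Pair:
  assumes "piecewise_continuous (\<lambda>t. (f t, g t))"
  shows "finite ({t. \<not> (isCont f t \<and> isCont g t)} \<inter> {a..b})"
proof (rule finite_subset)
  show "finite {t \<in> {a..b}. \<not> isCont (\<lambda>t. (f t, g t)) t}"
    using assms unfolding piecewise_continuous_def by blast
  show "{t. \<not> (isCont f t \<and> isCont g t)} \<inter> {a..b} \<subseteq> {t \<in> {a..b}. \<not> isCont (\<lambda>t. (f t, g t)) t}"
    using continuous_fst continuous_snd by fastforce
qed

text \<open>Division and \<open>tan\<close> are total in HOL; \<open>well_defined\<close> expresses
  that on the ball \<open>f_cl\<close> is the field of the model and not an artificial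
  value.\<close>

theorem theorem2:
  fixes L1 L2 L3 M1 v3 r :: real
    and W P Q :: "real^4^4" and K :: "real^4^1"
    and PP :: "(real^4) set" and UU :: "real set"
  assumes "L1 > 0" "L2 > 0" "L3 > 0" "v3 \<noteq> 0"
    and "psd W"
    and "is_lq_gain (lin_A L2 L3 v3) (lin_B L1 L2 M1 v3) W K"
    and "\<forall>p0\<in>PP. p0 $ 1 = 0 \<and> p0 $ 2 = 0"
    and "bounded PP" "bounded UU"
    and "r > 0"
    and well_defined: "\<forall>p0\<in>PP. \<forall>u0\<in>UU. ball 0 r \<subseteq> cl_domain L1 L3 M1 K p0 u0"
    and differentiable: "\<forall>p0\<in>PP. \<forall>u0\<in>UU. \<forall>p\<in>ball 0 r.
           (\<lambda>q. f_cl L1 L2 L3 M1 v3 K q p0 u0) differentiable (at p)"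
    and C1: "\<forall>p0\<in>PP. \<forall>u0\<in>UU.
           continuous_on (ball 0 r) (\<lambda>p. cl_jacobian L1 L2 L3 M1 v3 K p p0 u0)"
    and jacobian_bounded: "\<exists>C. \<forall>p0\<in>PP. \<forall>u0\<in>UU. \<forall>p\<in>ball 0 r.
           norm (cl_jacobian L1 L2 L3 M1 v3 K p p0 u0) \<le> C"
    and jacobian_Lipschitz: "\<exists>C. \<forall>p0\<in>PP. \<forall>u0\<in>UU.
           C-lipschitz_on (ball 0 r) (\<lambda>p. cl_jacobian L1 L2 L3 M1 v3 K p p0 u0)"
    and "pos_def P" "pos_def Q"
    and LMI: "\<forall>Acl \<in> convex hull {A_cl L1 L2 L3 M1 v3 K p0 u0 | p0 u0. p0 \<in> PP \<and> u0 \<in> UU}.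
           P ** Acl + transpose Acl ** P \<preceq>\<^sub>L - Q"
  shows "robustly_exponentially_stable (f_cl L1 L2 L3 M1 v3 K) (cl_domain L1 L3 M1 K)
           (ball 0 r) PP UU"
proof -
  let ?f = "f_cl L1 L2 L3 M1 v3 K"
  obtain L where L: "\<And>p0 u0 p. p0 \<in> PP \<Longrightarrow> u0 \<in> UU \<Longrightarrow> p \<in> ball 0 r \<Longrightarrow>
      norm (cl_jacobian L1 L2 L3 M1 v3 K p p0 u0) \<le> L"
    using jacobian_bounded by blast
  obtain C where C: "\<And>p0 u0. p0 \<in> PP \<Longrightarrow> u0 \<in> UU \<Longrightarrow>
      C-lipschitz_on (ball 0 r) (\<lambda>p. cl_jacobian L1 L2 L3 M1 v3 K p p0 u0)"
    using jacobian_Lipschitz by blast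
  obtain q where q: "q > 0" "\<And>v. q * (norm v)\<^sup>2 \<le> v \<bullet> (Q *v v)"
    using pos_def_coercive[OF \<open>pos_def Q\<close>] by blast
  have sym: "transpose P = P" using \<open>pos_def P\<close> unfolding pos_def_def by blast
  \<comment> \<open>Chosen so that the remainder contributes at most
    \<open>B * norm v / 4 * (norm v)\<^sup>2\<close> to
    \<open>v \<bullet> (P *v ?f v p0 u0)\<close>; with \<open>B * \<rho> \<le> q\<close>, twice this
    is half of the decay \<open>q\<close>. \<open>\<bar>C\<bar> + 1\<close> is positive even for an
    empty parameter set, where \<open>C\<close> has no known sign.\<close>
  define B where "B = 4 * (norm P + 1) * (\<bar>C\<bar> + 1)"
  have "B > 0" unfolding B_def by (intro mult_pos_pos add_nonneg_pos) auto
  define \<rho> where "\<rho> = min (r / 2) (q / B)"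
  have \<rho>: "0 < \<rho>" "\<rho> < r" "B * \<rho> \<le> q"
    using \<open>r > 0\<close> q(1) \<open>B > 0\<close> by (auto simp: \<rho>_def min_le_iff_disj field_simps min_def)

  have lip: "norm (?f v p0 u0 - ?f w p0 u0) \<le> (\<bar>L\<bar> + 1) * norm (v - w)"
    if "p0 \<in> PP" "u0 \<in> UU" "norm v \<le> \<rho>" "norm w \<le> \<rho>" for p0 u0 v w
  proof (rule jacobian_bound_imp_lipschitz[OF convex_ball[of 0 r]])
    fix x :: "real^4" assume x: "x \<in> ball 0 r"
    show "(\<lambda>q. ?f q p0 u0) differentiable (at x)" using differentiable that x by blast
    show "norm (jacobian (\<lambda>q. ?f q p0 u0) (at x)) \<le> \<bar>L\<bar> + 1"
      using L[OF that(1,2) x] unfolding cl_jacobian_def by linarith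
  qed (use that \<rho> in auto)

  have decay: "2 * (v \<bullet> (P *v ?f v p0 u0)) \<le> - (q / 2) * (norm v)\<^sup>2"
    if p0: "p0 \<in> PP" and u0: "u0 \<in> UU" and v: "norm v \<le> \<rho>" for p0 u0 v
  proof -
    let ?A = "A_cl L1 L2 L3 M1 v3 K p0 u0"
    let ?R = "?f v p0 u0 - ?A *v v"
    have "norm ?R \<le> C * (norm v)\<^sup>2"
      unfolding A_cl_def cl_jacobian_def
      by (rule linearization_error[where r = r])
        (use differentiable C[OF p0 u0] p0 u0 v \<rho> in \<open>auto simp: f_cl_0 cl_jacobian_def\<close>)
    also have "\<dots> \<le> (\<bar>C\<bar> + 1) * (norm v)\<^sup>2" by (intro mult_right_mono) auto
    finally have R: "norm ?R \<le> (\<bar>C\<bar> + 1) * (norm v)\<^sup>2" .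
    have "v \<bullet> (P *v ?R) \<le> norm v * norm (P *v ?R)" by (rule norm_cauchy_schwarz)
    also have "\<dots> \<le> norm v * (norm P * norm ?R)"
      by (intro mult_left_mono norm_matrix_vector_le) auto
    also have "\<dots> \<le> norm v * ((norm P + 1) * ((\<bar>C\<bar> + 1) * (norm v)\<^sup>2))"
      using R by (intro mult_left_mono mult_mono) auto
    also have "\<dots> = B * norm v / 4 * (norm v)\<^sup>2" by (simp add: B_def)
    also have "\<dots> \<le> q / 4 * (norm v)\<^sup>2"
    proof -
      have "B * norm v \<le> B * \<rho>" using v \<open>B > 0\<close> by simp
      then show ?thesis using \<rho>(3) by (intro mult_right_mono) auto
    qed
    finally have R': "v \<bullet> (P *v ?R) \<le> q / 4 * (norm v)\<^sup>2" .
    have "?A \<in> convex hull {A_cl L1 L2 L3 M1 v3 K p0 u0 | p0 u0. p0 \<in> PP \<and> u0 \<in> UU}"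
      using p0 u0 by (intro hull_inc) blast
    then have "2 * (v \<bullet> (P *v (?A *v v))) \<le> - (v \<bullet> (Q *v v))"
      using LMI by (intro lyapunov_inequality[OF sym]) blast
    moreover have "P *v ?f v p0 u0 = P *v (?A *v v) + P *v ?R"
      by (simp flip: matrix_vector_right_distrib)
    ultimately show ?thesis
      using R' q(2)[of v] by (simp add: inner_add_right)
  qed

  show ?thesis
    unfolding robustly_exponentially_stable_def
  proof (intro allI impI)
    fix p0 :: "real \<Rightarrow> real^4" and u0 :: "real \<Rightarrow> real"
    assume in_PU: "\<forall>t. p0 t \<in> PP \<and> u0 t \<in> UU"
      and pc: "piecewise_continuous (\<lambda>t. (p0 t, u0 t))"
    have dom: "cball 0 \<rho> \<subseteq> cl_domain L1 L3 M1 K (p0 t) (u0 t)" for t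
    proof -
      have "cball 0 \<rho> \<subseteq> ball (0 :: real^4) r" using \<rho>(2) by (auto simp: subset_iff)
      also have "\<dots> \<subseteq> cl_domain L1 L3 M1 K (p0 t) (u0 t)" using well_defined in_PU by blast
      finally show ?thesis .
    qed
    show "exponentially_stable_origin (\<lambda>t p. ?f p (p0 t) (u0 t))
        (\<lambda>t. cl_domain L1 L3 M1 K (p0 t) (u0 t))"
    proof (rule quadratic_lyapunov_exponentially_stable[OF \<open>pos_def P\<close>])
      \<comment> \<open>The exceptional set \<open>E\<close> consists of the times at which one of
        the two parameter signals is discontinuous.\<close>
      show "finite ({t. \<not> (isCont p0 t \<and> isCont u0 t)} \<inter> {a..b})" for a b
        by (rule finite_discontinuities_Pair[OF pc])
      show "isCont (\<lambda>s. ?f v (p0 s) (u0 s)) t"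
        if "t \<notin> {t. \<not> (isCont p0 t \<and> isCont u0 t)}" "norm v \<le> \<rho>" for t v
        using that dom[of t] by (intro isCont_f_cl assms(1-3)) auto
      show "cball 0 \<rho> \<subseteq> cl_domain L1 L3 M1 K (p0 t) (u0 t)" for t by (rule dom)
      show "norm (?f v (p0 t) (u0 t) - ?f w (p0 t) (u0 t)) \<le> (\<bar>L\<bar> + 1) * norm (v - w)"
        if "norm v \<le> \<rho>" "norm w \<le> \<rho>" for t v w
        using lip in_PU that by blast
      show "2 * (v \<bullet> (P *v ?f v (p0 t) (u0 t))) \<le> - (q / 2) * (norm v)\<^sup>2"
        if "norm v \<le> \<rho>" for t v
        using decay in_PU that by blast
    qed (use \<rho>(1) q(1) f_cl_0 in auto)
  qed
qed

end
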